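(* For a matroid $\mathcal{M}$ the following are equivalent: (a) $\mathcal{M}$ is Rayleigh; (b) every matroid of the form $\mathcal{M}[\mathbf{m}]$ is Rayleigh; (c) every matroid of the form $\mathcal{M}[\mathbf{m}]$ is balanced; (d) every matroid of the form $\mathcal{M}[\mathbf{m}]$ is negatively correlated. Here $\mathbf{m}$ ranges over all families $\{m_e:e\in E(\mathcal{M})\}$ of positive integers.
   Context: For a matroid $\mathcal{M}$ on a finite set $E$ with indeterminates $\mathbf{y}=\{y_c:c\in E\}$ and disjoint $I,J\subseteq E$, $M_I^J(\mathbf{y}):=\sum_B\prod_{c\in B\setminus I}y_c$, summed over bases $B$ with $I\subseteq B$, $B\cap J=\varnothing$. For distinct $e,f$: $\Delta M\{e,f\}:=M_e^fM_f^e-M_{ef}M^{ef}$. $\mathcal{M}$ is Rayleigh if $\Delta M\{e,f\}(\mathbf{y})\ge0$ for all distinct $e,f$ whenever all $y_c>0$; negatively correlated if $\Delta M\{e,f\}(\mathbf{1})\ge0$ for all distinct $e,f$ (all $y_c=1$); balanced if every minor is negatively correlated. For positive integers $\mathbf{m}=\{m_e:e\in E\}$, $\mathcal{M}[\mathbf{m}]$ is the matroid obtained from $\mathcal{M}$ by replacing each element $e$ by a parallel class of $m_e$ elements. *)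

theory Defs
  imports Complex_Main
begin

record 'a base_system =
  ground :: "'a set"
  bases :: "'a set set"

locale matroid =
  fixes M :: "'a base_system"
  assumes finite_ground: "finite (ground M)"
    and bases_subset: "B \<in> bases M \<Longrightarrow> B \<subseteq> ground M"
    and bases_nonempty: "bases M \<noteq> {}"
    and base_exchange:
      "\<lbrakk>B1 \<in> bases M; B2 \<in> bases M; x \<in> B1 - B2\<rbrakk>
        \<Longrightarrow> \<exists>y \<in> B2 - B1. insert y (B1 - {x}) \<in> bases M"

definition indep :: "'a base_system \<Rightarrow> 'a set \<Rightarrow> bool" where
  "indep M X \<longleftrightarrow> (\<exists>B \<in> bases M. X \<subseteq> B)"

definition dual :: "'a base_system \<Rightarrow> 'a base_system" where
  "dual M = \<lparr>ground = ground M, bases = {ground M - B | B. B \<in> bases M}\<rparr>"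

text \<open>The bases of a deletion are the maximal independent sets avoiding \<open>J\<close>; they are not
  just the bases of \<open>M\<close> avoiding \<open>J\<close>, of which there may be none (for instance if \<open>J\<close>
  contains a coloop).\<close>

definition delete :: "'a base_system \<Rightarrow> 'a set \<Rightarrow> 'a base_system" where
  "delete M J =
    \<lparr>ground = ground M - J,
     bases = {X. X \<subseteq> ground M - J \<and> indep M X \<and>
                 (\<forall>Y. X \<subseteq> Y \<and> Y \<subseteq> ground M - J \<and> indep M Y \<longrightarrow> Y = X)}\<rparr>"

definition contract :: "'a base_system \<Rightarrow> 'a set \<Rightarrow> 'a base_system" where
  "contract M I = dual (delete (dual M) I)"

definition is_minor :: "'a base_system \<Rightarrow> 'a base_system \<Rightarrow> bool" where
  "is_minor N M \<longleftrightarrow>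
    (\<exists>I J. I \<subseteq> ground M \<and> J \<subseteq> ground M \<and> I \<inter> J = {} \<and> N = delete (contract M I) J)"

text \<open>\<open>base_poly M I J y\<close> is the value at \<open>y\<close> of the polynomial $M_I^J$. Only values at real
  points occur in the notions below, so polynomials are represented by their evaluations.\<close>

definition base_poly ::
    "'a base_system \<Rightarrow> 'a set \<Rightarrow> 'a set \<Rightarrow> ('a \<Rightarrow> real) \<Rightarrow> real" where
  "base_poly M I J y =
    (\<Sum>B | B \<in> bases M \<and> I \<subseteq> B \<and> B \<inter> J = {}. \<Prod>c \<in> B - I. y c)"

definition rayleigh_diff :: "'a base_system \<Rightarrow> 'a \<Rightarrow> 'a \<Rightarrow> ('a \<Rightarrow> real) \<Rightarrow> real" where
  "rayleigh_diff M e f y =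
    base_poly M {e} {f} y * base_poly M {f} {e} y
    - base_poly M {e, f} {} y * base_poly M {} {e, f} y"

definition rayleigh :: "'a base_system \<Rightarrow> bool" where
  "rayleigh M \<longleftrightarrow>
    (\<forall>e \<in> ground M. \<forall>f \<in> ground M. e \<noteq> f \<longrightarrow>
      (\<forall>y. (\<forall>c \<in> ground M. y c > 0) \<longrightarrow> rayleigh_diff M e f y \<ge> 0))"

definition negatively_correlated :: "'a base_system \<Rightarrow> bool" where
  "negatively_correlated M \<longleftrightarrow>
    (\<forall>e \<in> ground M. \<forall>f \<in> ground M. e \<noteq> f \<longrightarrow> rayleigh_diff M e f (\<lambda>_. 1) \<ge> 0)"

definition balanced :: "'a base_system \<Rightarrow> bool" where
  "balanced M \<longleftrightarrow> (\<forall>N. is_minor N M \<longrightarrow> negatively_correlated N)"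

text \<open>\<open>parallel_ext M m\<close> is $M[m]$: the copies of \<open>e\<close> are \<open>(e, 0), \<dots>, (e, m e - 1)\<close>, and
  a basis is obtained from a basis of \<open>M\<close> by choosing one copy of each of its elements.
  A loop of \<open>M\<close> is thereby replaced by \<open>m e\<close> loops.\<close>

definition parallel_ext :: "'a base_system \<Rightarrow> ('a \<Rightarrow> nat) \<Rightarrow> ('a \<times> nat) base_system" where
  "parallel_ext M m =
    \<lparr>ground = (SIGMA e : ground M. {..<m e}),
     bases = {X. X \<subseteq> (SIGMA e : ground M. {..<m e}) \<and> inj_on fst X \<and> fst ` X \<in> bases M}\<rparr>"

definition multiplicities :: "'a base_system \<Rightarrow> ('a \<Rightarrow> nat) set" where
  "multiplicities M = {m. \<forall>e \<in> ground M. m e > 0}"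

end

theory Submission
  imports Defs "HOL-Library.FuncSet"
begin

text \<open>
  Summing the weights over each parallel class turns the basis polynomial of $M[m]$ into that of
  $M$, and since $\Delta M\{e,f\}$ depends on neither $y_e$ nor $y_f$, the Rayleigh differences of
  $M[m]$ at two non-parallel elements are those of $M$ at the summed weights; for parallel
  elements, $M_{ef} = 0$. Hence $M[m]$ inherits the Rayleigh property. The Rayleigh property passes
  to deletions (put weight $0$ on the deleted element, or weight $1$ if it is a coloop) and to
  duals (invert the weights), hence to minors. Conversely, negative correlation of all $M[m]$ says that the Rayleigh differences of
  $M$ are nonnegative at positive integer points; homogeneity and continuity carry this to all
  positive real points.
\<close>

section \<open>Bases and minors\<close>

lemma finite_bases: "matroid M \<Longrightarrow> finite (bases M)"
  using matroid.bases_subset matroid.finite_ground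
  by (metis Pow_iff finite_Pow_iff finite_subset subsetI)

lemma finite_base: "matroid M \<Longrightarrow> B \<in> bases M \<Longrightarrow> finite B"
  using matroid.bases_subset matroid.finite_ground finite_subset by metis

text \<open>An element of \<open>B - A\<close> could be exchanged out of \<open>B\<close> only for
  an element of \<open>A - B\<close>, which is empty.\<close>

lemma base_subset_imp_eq:
  assumes "matroid M" "A \<in> bases M" "B \<in> bases M" "A \<subseteq> B"
  shows "A = B"
  using matroid.base_exchange[OF assms(1,3,2)] assms(4) by blast

lemma base_indep_maximal:
  assumes M: "matroid M" and B: "B \<in> bases M" and "B \<subseteq> Y" "indep M Y"
  shows "Y = B"
  using base_subset_imp_eq[OF M B] assms(3,4) unfolding indep_def by blast

text \<open>Exchanging an element of \<open>A - B\<close> for one of \<open>B - A\<close> keeps the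
  size of \<open>A\<close> and shrinks \<open>A - B\<close>, until inclusion forces equality.
  Homogeneity of the basis polynomials rests on this.\<close>

lemma card_base_eq:
  assumes M: "matroid M" and "A \<in> bases M" and "B \<in> bases M"
  shows "card A = card B"
  using assms(2)
proof (induction "card (A - B)" arbitrary: A)
  case 0
  then have "A \<subseteq> B"
    using finite_base[OF M] by auto
  then show ?case
    using base_subset_imp_eq[OF M 0(2) assms(3)] by simp
next
  case (Suc n)
  then obtain x where x: "x \<in> A - B"
    by (metis card.empty equals0I nat.distinct(1))
  then obtain y where y: "y \<in> B - A" "insert y (A - {x}) \<in> bases M"
    using matroid.base_exchange[OF M Suc(3) assms(3)] by blast
  have fin: "finite A"
    using finite_base[OF M Suc(3)] .
  have "insert y (A - {x}) - B = (A - B) - {x}"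
    using y by blast
  then have "n = card (insert y (A - {x}) - B)"
    using x Suc(2) fin by simp
  then have "card (insert y (A - {x})) = card B"
    using Suc(1) y(2) by blast
  moreover have "card A > 0"
    using x fin by (auto simp: card_gt_0_iff)
  then have "card (insert y (A - {x})) = card A"
    using x y(1) fin by simp
  ultimately show ?case by simp
qed

section \<open>Duality\<close>

lemma base_exchange_dual:
  assumes M: "matroid M" and A: "A \<in> bases M" and B: "B \<in> bases M" and x: "x \<in> B - A"
  shows "\<exists>y \<in> A - B. insert x (A - {y}) \<in> bases M"
proof -
  \<comment> \<open>Among the bases containing \<open>x\<close> and \<open>A \<inter> B\<close>,
    choose \<open>C\<close> with the fewest elements outside \<open>insert x A\<close>. Minimality
    forces \<open>C\<close> into \<open>insert x A\<close>, so an exchange from \<open>A\<close>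
    towards \<open>C\<close> can only bring in \<open>x\<close>.\<close>
  let ?P = "\<lambda>C. C \<in> bases M \<and> insert x (A \<inter> B) \<subseteq> C"
  have "?P B"
    using B x by auto
  then obtain C where C: "?P C"
    and min: "\<And>D. ?P D \<Longrightarrow> card (C - insert x A) \<le> card (D - insert x A)"
    using ex_has_least_nat[of ?P B "\<lambda>C. card (C - insert x A)"] by blast
  have "C \<subseteq> insert x A"
  proof (rule ccontr)
    assume "\<not> C \<subseteq> insert x A"
    then obtain z where z: "z \<in> C - insert x A" by blast
    then obtain y where y: "y \<in> A - C" "insert y (C - {z}) \<in> bases M"
      using matroid.base_exchange[OF M _ A, of C z] C by blast
    \<comment> \<open>\<open>z\<close> lies outside \<open>insert x A\<close>, so removing it loses
      neither \<open>x\<close> nor an element of \<open>A \<inter> B\<close>.\<close>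
    have "?P (insert y (C - {z}))"
      using C y z by blast
    then have "card (C - insert x A) \<le> card (insert y (C - {z}) - insert x A)"
      by (rule min)
    also have "insert y (C - {z}) - insert x A = C - insert x A - {z}"
      using y(1) by blast
    also have "card (C - insert x A - {z}) < card (C - insert x A)"
      using finite_base[OF M, of C] C z by (intro card_Diff1_less) auto
    finally show False by simp
  qed
  moreover have "\<not> A \<subseteq> C"
    using base_subset_imp_eq[OF M A, of C] C x by blast
  \<comment> \<open>Such a \<open>y\<close> is outside \<open>B\<close>, since \<open>C\<close>
    contains \<open>A \<inter> B\<close>; its replacement lies in \<open>C - A\<close>, which leaves
    only \<open>x\<close>.\<close>
  ultimately obtain y where y: "y \<in> A - C" by blast
  then obtain z where z: "z \<in> C - A" "insert z (A - {y}) \<in> bases M"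
    using matroid.base_exchange[OF M A, of C y] C by blast
  then have "z = x"
    using \<open>C \<subseteq> insert x A\<close> by blast
  with y z C show ?thesis by blast
qed

text \<open>Removing \<open>x\<close> from \<open>B1\<close> adds it to the complement of
  \<open>B1\<close>, so exchange in the dual is \<open>base_exchange_dual\<close>, the exchange in
  which the incoming element is prescribed.\<close>

lemma matroid_dual:
  assumes M: "matroid M"
  shows "matroid (dual M)"
proof
  show "finite (ground (dual M))"
    using matroid.finite_ground[OF M] by (simp add: dual_def)
  show "B \<in> bases (dual M) \<Longrightarrow> B \<subseteq> ground (dual M)" for B
    by (auto simp: dual_def)
  show "bases (dual M) \<noteq> {}"
    using matroid.bases_nonempty[OF M] by (auto simp: dual_def)
  fix B1 B2 x
  assume "B1 \<in> bases (dual M)" "B2 \<in> bases (dual M)" and x: "x \<in> B1 - B2"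
  then obtain A1 A2 where A: "A1 \<in> bases M" "A2 \<in> bases M"
    and B: "B1 = ground M - A1" "B2 = ground M - A2"
    by (auto simp: dual_def)
  then obtain y where y: "y \<in> A1 - A2" "insert x (A1 - {y}) \<in> bases M"
    using base_exchange_dual[OF M A] x by blast
  have "insert y (B1 - {x}) = ground M - insert x (A1 - {y})"
    using x y matroid.bases_subset[OF M A(1)] unfolding B by blast
  then show "\<exists>y \<in> B2 - B1. insert y (B1 - {x}) \<in> bases (dual M)"
    using y matroid.bases_subset[OF M A(1)] by (auto simp: dual_def B)
qed

lemma dual_dual:
  assumes M: "matroid M"
  shows "dual (dual M) = M"
proof -
  have "bases (dual (dual M)) = (\<lambda>B. ground M - (ground M - B)) ` bases M"
    by (auto simp: dual_def)
  also have "\<dots> = (\<lambda>B. B) ` bases M"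
    using matroid.bases_subset[OF M] by (intro image_cong refl double_diff) auto
  finally have "bases (dual (dual M)) = bases M" by simp
  then show ?thesis
    by (intro base_system.equality) (simp_all add: dual_def)
qed

section \<open>Deletion\<close>

lemma indep_delete_iff:
  assumes M: "matroid M"
  shows "indep (delete M J) X \<longleftrightarrow> X \<subseteq> ground M - J \<and> indep M X"
proof
  show "X \<subseteq> ground M - J \<and> indep M X" if "indep (delete M J) X"
  proof -
    from that obtain B where B: "B \<in> bases (delete M J)" "X \<subseteq> B"
      unfolding indep_def by blast
    then have "B \<subseteq> ground M - J" "indep M B"
      by (simp_all add: delete_def)
    with B(2) show ?thesis
      unfolding indep_def by blast
  qed
  assume X: "X \<subseteq> ground M - J \<and> indep M X"
  let ?S = "{Y. Y \<subseteq> ground M - J \<and> indep M Y}"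
  \<comment> \<open>Finiteness extends \<open>X\<close> to a maximal member of \<open>?S\<close>,
    which by definition is a basis of the deletion.\<close>
  have "finite ?S"
    by (rule finite_subset[of _ "Pow (ground M)"]) (use matroid.finite_ground[OF M] in auto)
  then obtain Y where Y: "Y \<in> ?S" "X \<subseteq> Y" "\<forall>Z\<in>?S. Y \<subseteq> Z \<longrightarrow> Y = Z"
    using finite_has_maximal2[of ?S X] X by blast
  then have "Y \<in> bases (delete M J)"
    by (auto simp: delete_def)
  with Y(2) show "indep (delete M J) X"
    unfolding indep_def by blast
qed

text \<open>Reduces deletion of a finite set to single elements: by \<open>indep_delete_iff\<close>
  both sides have the same independent sets, hence the same maximal ones.\<close>

lemma delete_insert:
  assumes "matroid M"
  shows "delete M (insert j J) = delete (delete M J) {j}"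
proof -
  have ground: "ground (delete M J) - {j} = ground M - insert j J"
    by (auto simp: delete_def)
  \<comment> \<open>Unfolding the nested deletion leaves a redundant inclusion in
    \<open>ground M - J\<close>; once it is absorbed, the two descriptions agree literally.\<close>
  have absorb: "Y \<subseteq> ground M - insert j J \<and> Y \<subseteq> ground M - J \<and> Q
      \<longleftrightarrow> Y \<subseteq> ground M - insert j J \<and> Q" for Y Q
    by blast
  show ?thesis
    unfolding delete_def[of M "insert j J"] delete_def[of "delete M J"]
    by (simp only: ground indep_delete_iff[OF assms] conj_assoc absorb)
qed

lemma delete_empty:
  assumes M: "matroid M"
  shows "delete M {} = M"
proof -
  have "{X. X \<subseteq> ground M \<and> indep M X \<and> (\<forall>Y. X \<subseteq> Y \<and> Y \<subseteq> ground M \<and> indep M Y \<longrightarrow> Y = X)}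
      = bases M" (is "?L = _")
  proof
    show "?L \<subseteq> bases M"
    proof
      fix X assume X: "X \<in> ?L"
      then obtain B where B: "B \<in> bases M" "X \<subseteq> B"
        unfolding indep_def by blast
      then have "indep M B"
        unfolding indep_def by blast
      then have "B = X"
        using X B matroid.bases_subset[OF M B(1)] by blast
      with B(1) show "X \<in> bases M" by simp
    qed
    show "bases M \<subseteq> ?L"
      using matroid.bases_subset[OF M] base_subset_imp_eq[OF M] unfolding indep_def by blast
  qed
  then show ?thesis
    by (simp add: delete_def)
qed

text \<open>The independent sets avoiding the coloop \<open>j\<close> are the subsets of the sets
  \<open>B - {j}\<close>. None of these strictly contains another, since restoring \<open>j\<close>
  gives an inclusion of bases.\<close>

lemma bases_delete_coloop:
  assumes M: "matroid M" and j: "\<forall>B \<in> bases M. j \<in> B"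
  shows "bases (delete M {j}) = (\<lambda>B. B - {j}) ` bases M"
proof -
  have indep: "indep M Y \<and> Y \<subseteq> ground M - {j} \<longleftrightarrow> (\<exists>B\<in>bases M. Y \<subseteq> B - {j})" for Y
    using matroid.bases_subset[OF M] by (auto simp: indep_def)
  have max: "A - {j} = B - {j}" if "A \<in> bases M" "B \<in> bases M" "A - {j} \<subseteq> B - {j}" for A B
    using base_subset_imp_eq[OF M that(1,2)] that j by blast
  have "bases (delete M {j}) =
      {X. (\<exists>B\<in>bases M. X \<subseteq> B - {j}) \<and> (\<forall>Y. X \<subseteq> Y \<and> (\<exists>B\<in>bases M. Y \<subseteq> B - {j}) \<longrightarrow> Y = X)}"
    unfolding delete_def indep[symmetric] by auto
  also have "\<dots> = (\<lambda>B. B - {j}) ` bases M" (is "?L = ?R")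
  proof
    show "?L \<subseteq> ?R" by blast
    show "?R \<subseteq> ?L"
      using max by (smt (verit) image_subset_iff mem_Collect_eq order_refl subset_antisym subset_trans)
  qed
  finally show ?thesis .
qed

text \<open>An independent set avoiding \<open>j\<close> extends to a basis avoiding
  \<open>j\<close>: if the basis found contains \<open>j\<close>, exchange \<open>j\<close> out
  against \<open>A\<close>. Hence the maximal such sets are bases of \<open>M\<close>.\<close>

lemma bases_delete_noncoloop:
  assumes M: "matroid M" and A: "A \<in> bases M" "j \<notin> A"
  shows "bases (delete M {j}) = {B \<in> bases M. j \<notin> B}"
proof -
  have ex: "\<exists>C \<in> bases M. j \<notin> C \<and> X \<subseteq> C" if "indep M X" "j \<notin> X" for X
  proof -
    from that obtain B where B: "B \<in> bases M" "X \<subseteq> B"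
      by (auto simp: indep_def)
    show ?thesis
    proof (cases "j \<in> B")
      case True
      then obtain y where y: "y \<in> A - B" "insert y (B - {j}) \<in> bases M"
        using matroid.base_exchange[OF M B(1) A(1), of j] True A(2) by blast
      have "j \<notin> insert y (B - {j})"
        using y(1) A(2) by blast
      moreover have "X \<subseteq> insert y (B - {j})"
        using B(2) that(2) by blast
      ultimately have "j \<notin> insert y (B - {j}) \<and> X \<subseteq> insert y (B - {j})" ..
      then show ?thesis
        using y(2) by (rule bexI)
    qed (use B in blast)
  qed
  show ?thesis (is "?L = ?R")
  proof
    show "?L \<subseteq> ?R"
    proof
      fix X assume X: "X \<in> ?L"
      then have "indep M X" "j \<notin> X"
        by (auto simp: delete_def)
      then obtain C where C: "C \<in> bases M" "j \<notin> C" "X \<subseteq> C"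
        using ex by blast
      have "indep M C"
        using C(1) unfolding indep_def by blast
      moreover have "C \<subseteq> ground M - {j}"
        using matroid.bases_subset[OF M C(1)] C(2) by blast
      ultimately have "C = X"
        using X C(3) by (simp add: delete_def)
      with C show "X \<in> ?R" by blast
    qed
    show "?R \<subseteq> ?L"
    proof
      fix B assume B: "B \<in> ?R"
      then have "B \<subseteq> ground M - {j}"
        using matroid.bases_subset[OF M, of B] by blast
      moreover have "indep M B"
        using B unfolding indep_def by blast
      ultimately show "B \<in> ?L"
        using base_indep_maximal[OF M, of B] B by (simp add: delete_def)
    qed
  qed
qed

lemma matroid_delete_single:
  assumes M: "matroid M"
  shows "matroid (delete M {j})"
proof
  show "finite (ground (delete M {j}))"
    using matroid.finite_ground[OF M] by (simp add: delete_def)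
  show "B \<in> bases (delete M {j}) \<Longrightarrow> B \<subseteq> ground (delete M {j})" for B
    by (simp add: delete_def)
  show "bases (delete M {j}) \<noteq> {}"
    using bases_delete_coloop[OF M, of j] bases_delete_noncoloop[OF M, of _ j]
      matroid.bases_nonempty[OF M]
    by (cases "\<forall>B\<in>bases M. j \<in> B") auto
  fix B1 B2 x
  assume B: "B1 \<in> bases (delete M {j})" "B2 \<in> bases (delete M {j})" and x: "x \<in> B1 - B2"
  show "\<exists>y \<in> B2 - B1. insert y (B1 - {x}) \<in> bases (delete M {j})"
  proof (cases "\<forall>B\<in>bases M. j \<in> B")
    case True
    note bases = bases_delete_coloop[OF M True]
    from B obtain C1 C2 where C: "C1 \<in> bases M" "C2 \<in> bases M"
      and eq: "B1 = C1 - {j}" "B2 = C2 - {j}"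
      unfolding bases by blast
    \<comment> \<open>The exchange is made in \<open>M\<close>. As \<open>j\<close> belongs to every
      basis, it is neither \<open>x\<close> nor \<open>y\<close>.\<close>
    then obtain y where y: "y \<in> C2 - C1" "insert y (C1 - {x}) \<in> bases M"
      using matroid.base_exchange[OF M C, of x] x True by blast
    then have "insert y (B1 - {x}) = insert y (C1 - {x}) - {j}"
      using True C eq by blast
    moreover have "y \<in> B2 - B1"
      using y True C eq by blast
    ultimately show ?thesis
      using y unfolding bases by blast
  next
    case False
    then obtain A where A: "A \<in> bases M" "j \<notin> A" by blast
    \<comment> \<open>The incoming element comes from \<open>B2\<close>, so the new basis avoids
      \<open>j\<close> as well.\<close>
    show ?thesis
      using B x matroid.base_exchange[OF M, of B1 B2 x]
      unfolding bases_delete_noncoloop[OF M A] by blast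
  qed
qed

section \<open>Basis polynomials\<close>

lemma base_poly_cong:
  assumes M: "matroid M" and "\<And>c. c \<in> ground M \<Longrightarrow> y c = z c"
  shows "base_poly M I J y = base_poly M I J z"
  unfolding base_poly_def using matroid.bases_subset[OF M] assms(2)
  by (intro sum.cong prod.cong refl) blast

lemma base_poly_nonneg:
  assumes "matroid M" and "\<And>c. c \<in> ground M \<Longrightarrow> y c \<ge> 0"
  shows "base_poly M I J y \<ge> 0"
  unfolding base_poly_def using assms matroid.bases_subset
  by (intro sum_nonneg prod_nonneg) blast

lemma tendsto_base_poly:
  assumes "\<And>c. ((\<lambda>x. y x c) \<longlongrightarrow> z c) F"
  shows "((\<lambda>x. base_poly M I J (y x)) \<longlongrightarrow> base_poly M I J z) F"
  unfolding base_poly_def by (intro tendsto_sum tendsto_prod assms)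

text \<open>\<open>F\<close> is arbitrary because limits are taken both at \<open>0\<close> from the
  right and along a sequence.\<close>

lemma tendsto_rayleigh_diff:
  assumes "\<And>c. ((\<lambda>x. y x c) \<longlongrightarrow> z c) F"
  shows "((\<lambda>x. rayleigh_diff M e f (y x)) \<longlongrightarrow> rayleigh_diff M e f z) F"
  unfolding rayleigh_diff_def by (intro tendsto_intros tendsto_base_poly assms)

text \<open>Continuity extends the inequality to the boundary of the positive orthant, so that a
  deleted element may receive weight \<open>0\<close>.\<close>

lemma rayleigh_diff_nonneg:
  assumes "rayleigh M" "e \<in> ground M" "f \<in> ground M" "e \<noteq> f" "\<And>c. c \<in> ground M \<Longrightarrow> y c \<ge> 0"
  shows "rayleigh_diff M e f y \<ge> 0"
proof (rule tendsto_lowerbound)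
  have "((\<lambda>t. y c + t) \<longlongrightarrow> y c) (at_right 0)" for c
    by (rule tendsto_eq_intros | simp)+
  then show "((\<lambda>t. rayleigh_diff M e f (\<lambda>c. y c + t)) \<longlongrightarrow> rayleigh_diff M e f y) (at_right 0)"
    by (rule tendsto_rayleigh_diff)
  show "\<forall>\<^sub>F t in at_right 0. rayleigh_diff M e f (\<lambda>c. y c + t) \<ge> 0"
    using eventually_at_right_less[of "0::real"]
    by eventually_elim (use assms in \<open>simp add: rayleigh_def add_nonneg_pos\<close>)
qed simp

text \<open>Complementation matches the bases of \<open>M\<close> containing \<open>J\<close> and
  avoiding \<open>I\<close> with the dual bases containing \<open>I\<close> and avoiding
  \<open>J\<close>; each monomial becomes the full product divided by the complementary
  monomial.\<close>

lemma base_poly_dual: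
  assumes M: "matroid M" and I: "I \<subseteq> ground M" and J: "J \<subseteq> ground M"
    and y: "\<And>c. c \<in> ground M \<Longrightarrow> y c > 0"
  shows "base_poly (dual M) I J y =
    (\<Prod>c \<in> ground M - I - J. y c) * base_poly M J I (\<lambda>c. inverse (y c))"
proof -
  let ?E = "ground M"
  let ?S = "{B. B \<in> bases M \<and> J \<subseteq> B \<and> B \<inter> I = {}}"
  have sub: "B \<subseteq> ?E" if "B \<in> bases M" for B
    using matroid.bases_subset[OF M that] .
  have img: "{B. B \<in> bases (dual M) \<and> I \<subseteq> B \<and> B \<inter> J = {}} = (\<lambda>B. ?E - B) ` ?S"
  proof (intro equalityI subsetI)
    fix X assume "X \<in> {B. B \<in> bases (dual M) \<and> I \<subseteq> B \<and> B \<inter> J = {}}"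
    then obtain B where B: "B \<in> bases M" and X: "X = ?E - B" "I \<subseteq> X" "X \<inter> J = {}"
      by (auto simp: dual_def)
    then have "J \<subseteq> B" "B \<inter> I = {}"
      using J by blast+
    with B X(1) show "X \<in> (\<lambda>B. ?E - B) ` ?S" by blast
  next
    fix X assume "X \<in> (\<lambda>B. ?E - B) ` ?S"
    then obtain B where B: "B \<in> bases M" "J \<subseteq> B" "B \<inter> I = {}" and X: "X = ?E - B" by blast
    then have "X \<in> bases (dual M)"
      by (auto simp: dual_def)
    moreover have "I \<subseteq> X" "X \<inter> J = {}"
      using I B(2,3) X by blast+
    ultimately show "X \<in> {B. B \<in> bases (dual M) \<and> I \<subseteq> B \<and> B \<inter> J = {}}" by blast
  qed
  have inj: "inj_on (\<lambda>B. ?E - B) ?S"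
    by (rule inj_onI) (use sub in blast)
  have "(\<Prod>c\<in>?E - B - I. y c) = (\<Prod>c\<in>?E - I - J. y c) * (\<Prod>c\<in>B - J. inverse (y c))"
    if B: "B \<in> ?S" for B
  proof -
    have fin: "finite (?E - B - I)" "finite (B - J)"
      using matroid.finite_ground[OF M] finite_base[OF M] B by auto
    have "?E - I - J = (?E - B - I) \<union> (B - J)"
      using B sub[of B] by auto
    then have "(\<Prod>c\<in>?E - I - J. y c) = (\<Prod>c\<in>?E - B - I. y c) * (\<Prod>c\<in>B - J. y c)"
      by (simp add: prod.union_disjoint[OF fin] Int_Diff disjoint_iff)
    moreover have "(\<Prod>c\<in>B - J. y c) * (\<Prod>c\<in>B - J. inverse (y c)) = 1"
      unfolding prod.distrib[symmetric]
    proof (rule prod.neutral, rule ballI)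
      fix c assume "c \<in> B - J"
      then have "y c > 0" using y sub[of B] B by blast
      then show "y c * inverse (y c) = 1" by simp
    qed
    ultimately show ?thesis by simp
  qed
  then show ?thesis
    unfolding base_poly_def img
    by (simp add: sum.reindex[OF inj] sum_distrib_left)
qed

section \<open>The Rayleigh property under duals, deletions and minors\<close>

lemma rayleigh_dual:
  assumes M: "matroid M" and R: "rayleigh M"
  shows "rayleigh (dual M)"
  unfolding rayleigh_def
proof (intro ballI impI allI)
  fix e f and y :: "'a \<Rightarrow> real"
  assume "e \<in> ground (dual M)" "f \<in> ground (dual M)" and ef: "e \<noteq> f"
    and "\<forall>c\<in>ground (dual M). y c > 0"
  then have e: "e \<in> ground M" and f: "f \<in> ground M" and y: "\<And>c. c \<in> ground M \<Longrightarrow> y c > 0"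
    by (auto simp: dual_def)
  let ?K = "\<Prod>c\<in>ground M - {e} - {f}. y c"
  let ?z = "\<lambda>c. inverse (y c)"
  \<comment> \<open>All four polynomials acquire the same factor \<open>?K\<close>, and dualizing
    merely swaps the two factors within each product, so the difference is multiplied by
    \<open>?K^2\<close>.\<close>
  have "ground M - {f} - {e} = ground M - {e} - {f}"
    "ground M - {e, f} - {} = ground M - {e} - {f}"
    "ground M - {} - {e, f} = ground M - {e} - {f}"
    by auto
  then have "rayleigh_diff (dual M) e f y = ?K^2 * rayleigh_diff M e f ?z"
    unfolding rayleigh_diff_def using base_poly_dual[OF M _ _ y] e f
    by (simp add: algebra_simps power2_eq_square)
  moreover have "rayleigh_diff M e f ?z \<ge> 0"
    using R e f ef y by (simp add: rayleigh_def)
  ultimately show "rayleigh_diff (dual M) e f y \<ge> 0" by simp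
qed

lemma rayleigh_delete_single:
  assumes M: "matroid M" and R: "rayleigh M"
  shows "rayleigh (delete M {j})"
  unfolding rayleigh_def
proof (intro ballI impI allI)
  let ?N = "delete M {j}"
  fix e f and y :: "'a \<Rightarrow> real"
  assume e': "e \<in> ground ?N" and f': "f \<in> ground ?N" and ef: "e \<noteq> f"
    and y: "\<forall>c\<in>ground ?N. y c > 0"
  then have e: "e \<in> ground M" "e \<noteq> j" and f: "f \<in> ground M" "f \<noteq> j"
    by (auto simp: delete_def)
  \<comment> \<open>A single \<open>t\<close> must serve all four polynomials. For a coloop every
    monomial contains the weight of \<open>j\<close>, so \<open>t = 1\<close> leaves its value
    unchanged; otherwise \<open>t = 0\<close> kills the monomials of the bases containing
    \<open>j\<close>.\<close>
  obtain t :: real where "t \<ge> 0" and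
    eq: "\<And>I J. j \<notin> I \<Longrightarrow> j \<notin> J \<Longrightarrow> base_poly ?N I J y = base_poly M I J (y(j := t))"
  proof (cases "\<forall>B\<in>bases M. j \<in> B")
    case True
    have "base_poly ?N I J y = base_poly M I J (y(j := 1))" if "j \<notin> I" "j \<notin> J" for I J
    proof -
      let ?S = "{B. B \<in> bases M \<and> I \<subseteq> B \<and> B \<inter> J = {}}"
      have img: "{B. B \<in> bases ?N \<and> I \<subseteq> B \<and> B \<inter> J = {}} = (\<lambda>B. B - {j}) ` ?S"
        unfolding bases_delete_coloop[OF M True] using that by auto
      have inj: "inj_on (\<lambda>B. B - {j}) ?S"
        by (rule inj_onI) (use True in blast)
      have "(\<Prod>c\<in>B - {j} - I. y c) = (\<Prod>c\<in>B - I. (y(j := 1)) c)" if B: "B \<in> ?S" for B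
      proof -
        have "finite (B - I)" "j \<in> B - I"
          using finite_base[OF M] B True \<open>j \<notin> I\<close> by auto
        moreover have "B - {j} - I = B - I - {j}" by auto
        ultimately show ?thesis
          by (simp add: prod.remove[of "B - I" j])
      qed
      then show ?thesis
        unfolding base_poly_def img by (simp add: sum.reindex[OF inj])
    qed
    then show ?thesis using that[of 1] by simp
  next
    case False
    then obtain A where A: "A \<in> bases M" "j \<notin> A" by blast
    have "base_poly ?N I J y = base_poly M I J (y(j := 0))" if "j \<notin> I" "j \<notin> J" for I J
      unfolding base_poly_def bases_delete_noncoloop[OF M A]
    proof (rule sum.mono_neutral_cong_left)
      show "finite {B \<in> bases M. I \<subseteq> B \<and> B \<inter> J = {}}"
        using finite_bases[OF M] by simp
      show "\<forall>B\<in>{B \<in> bases M. I \<subseteq> B \<and> B \<inter> J = {}} -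
          {B \<in> {B \<in> bases M. j \<notin> B}. I \<subseteq> B \<and> B \<inter> J = {}}. (\<Prod>c\<in>B - I. (y(j := 0)) c) = 0"
        using finite_base[OF M] \<open>j \<notin> I\<close> by (auto intro!: bexI[of _ j])
    qed (auto intro!: prod.cong)
    then show ?thesis using that[of 0] by simp
  qed
  have "rayleigh_diff ?N e f y = rayleigh_diff M e f (y(j := t))"
    unfolding rayleigh_diff_def using e f by (simp add: eq)
  moreover have "rayleigh_diff M e f (y(j := t)) \<ge> 0"
    using y \<open>t \<ge> 0\<close>
    by (intro rayleigh_diff_nonneg[OF R e(1) f(1) ef])
      (auto simp: delete_def less_imp_le)
  ultimately show "rayleigh_diff ?N e f y \<ge> 0" by simp
qed

text \<open>Being a matroid is carried along in the induction because each single deletion requires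
  it.\<close>

lemma rayleigh_delete:
  assumes "matroid M" "rayleigh M" "finite J"
  shows "matroid (delete M J) \<and> rayleigh (delete M J)"
  using assms(3)
proof induction
  case empty
  then show ?case using assms by (simp add: delete_empty)
next
  case (insert j J)
  then show ?case
    using assms(1) by (simp add: delete_insert[of M j J] matroid_delete_single rayleigh_delete_single)
qed

text \<open>A contraction is a deletion between two dualizations, so every minor stays Rayleigh;
  negative correlation is the inequality at unit weights.\<close>

lemma rayleigh_imp_balanced:
  assumes M: "matroid M" and R: "rayleigh M"
  shows "balanced M"
  unfolding balanced_def
proof (intro allI impI)
  fix N assume "is_minor N M"
  then obtain I J where "finite I" "finite J" and N: "N = delete (contract M I) J"
    unfolding is_minor_def using matroid.finite_ground[OF M] finite_subset by metis
  then have "rayleigh N"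
    using M R by (simp add: contract_def matroid_dual rayleigh_dual rayleigh_delete)
  then show "negatively_correlated N"
    by (simp add: rayleigh_def negatively_correlated_def)
qed

lemma balanced_imp_negatively_correlated:
  assumes M: "matroid M" and "balanced M"
  shows "negatively_correlated M"
proof -
  have "M = delete (contract M {}) {}"
    by (simp add: contract_def delete_empty matroid_dual dual_dual M)
  then have "is_minor M M"
    unfolding is_minor_def by blast
  then show ?thesis using assms by (simp add: balanced_def)
qed

section \<open>Expansion in two weights, and homogeneity\<close>

lemma base_poly_affine:
  assumes M: "matroid M" and ef: "e \<noteq> f"
  shows "base_poly M {} {} (y(e := u, f := v)) =
    base_poly M {} {e, f} y + u * base_poly M {e} {f} y
    + v * base_poly M {f} {e} y + u * v * base_poly M {e, f} {} y"
proof -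
  let ?z = "y(e := u, f := v)"
  let ?S = "\<lambda>I J. {B. B \<in> bases M \<and> I \<subseteq> B \<and> B \<inter> J = {}}"
  let ?p = "\<lambda>B. \<Prod>c\<in>B. ?z c"
  \<comment> \<open>A basis contains neither, exactly one or both of \<open>e\<close> and
    \<open>f\<close>; these four classes give the four coefficients of a polynomial affine in each
    of \<open>u\<close> and \<open>v\<close>.\<close>
  have split: "?S {} {} = ?S {} {e, f} \<union> (?S {e} {f} \<union> (?S {f} {e} \<union> ?S {e, f} {}))"
    by auto
  have union: "sum ?p (A \<union> A') = sum ?p A + sum ?p A'"
    if "A \<subseteq> bases M" "A' \<subseteq> bases M" "A \<inter> A' = {}" for A A'
    using that finite_bases[OF M] by (intro sum.union_disjoint) (auto intro: finite_subset)
  have "sum ?p (?S {} {}) =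
      sum ?p (?S {} {e, f}) + sum ?p (?S {e} {f} \<union> (?S {f} {e} \<union> ?S {e, f} {}))"
    unfolding split by (rule union) auto
  also have "sum ?p (?S {e} {f} \<union> (?S {f} {e} \<union> ?S {e, f} {})) =
      sum ?p (?S {e} {f}) + sum ?p (?S {f} {e} \<union> ?S {e, f} {})"
    by (rule union) auto
  also have "sum ?p (?S {f} {e} \<union> ?S {e, f} {}) = sum ?p (?S {f} {e}) + sum ?p (?S {e, f} {})"
    by (rule union) auto
  finally have "sum ?p (?S {} {}) =
      sum ?p (?S {} {e, f}) + (sum ?p (?S {e} {f}) + (sum ?p (?S {f} {e}) + sum ?p (?S {e, f} {})))" .
  moreover have "sum ?p (?S {} {e, f}) = base_poly M {} {e, f} y"
    unfolding base_poly_def by (auto intro!: sum.cong prod.cong)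
  moreover have "sum ?p (?S {e} {f}) = u * base_poly M {e} {f} y"
    unfolding base_poly_def sum_distrib_left
  proof (rule sum.cong[OF refl])
    fix B assume B: "B \<in> ?S {e} {f}"
    then have "?p B = u * (\<Prod>c\<in>B - {e}. ?z c)"
      using finite_base[OF M] ef by (subst prod.remove[of B e]) auto
    also have "(\<Prod>c\<in>B - {e}. ?z c) = (\<Prod>c\<in>B - {e}. y c)"
      using B by (intro prod.cong) auto
    finally show "?p B = u * (\<Prod>c\<in>B - {e}. y c)" .
  qed
  moreover have "sum ?p (?S {f} {e}) = v * base_poly M {f} {e} y"
    unfolding base_poly_def sum_distrib_left
  proof (rule sum.cong[OF refl])
    fix B assume B: "B \<in> ?S {f} {e}"
    then have "?p B = v * (\<Prod>c\<in>B - {f}. ?z c)"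
      using finite_base[OF M] ef by (subst prod.remove[of B f]) auto
    also have "(\<Prod>c\<in>B - {f}. ?z c) = (\<Prod>c\<in>B - {f}. y c)"
      using B by (intro prod.cong) auto
    finally show "?p B = v * (\<Prod>c\<in>B - {f}. y c)" .
  qed
  moreover have "sum ?p (?S {e, f} {}) = u * v * base_poly M {e, f} {} y"
    unfolding base_poly_def sum_distrib_left
  proof (rule sum.cong[OF refl])
    fix B assume B: "B \<in> ?S {e, f} {}"
    then have "?p B = u * (v * (\<Prod>c\<in>B - {e} - {f}. ?z c))"
      using finite_base[OF M, of B] ef
      by (subst prod.remove[of B e], simp, simp, subst prod.remove[of "B - {e}" f]) auto
    also have "(\<Prod>c\<in>B - {e} - {f}. ?z c) = (\<Prod>c\<in>B - {e, f}. y c)"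
      by (intro prod.cong) auto
    finally show "?p B = u * v * (\<Prod>c\<in>B - {e, f}. y c)"
      by (simp only: mult.assoc)
  qed
  ultimately show ?thesis
    by (simp add: base_poly_def)
qed

text \<open>The choice of the base point is immaterial because $\Delta M\{e,f\}$ does not depend on
  $y_e$ and $y_f$.\<close>

lemma rayleigh_diff_finite_differences:
  fixes u v :: real
  assumes "matroid M" "e \<noteq> f"
  defines "P \<equiv> \<lambda>a b y. base_poly M {} {} (y(e := a, f := b))"
  shows "rayleigh_diff M e f y =
    (P (u + 1) v y - P u v y) * (P u (v + 1) y - P u v y)
    - (P (u + 1) (v + 1) y - P (u + 1) v y - P u (v + 1) y + P u v y) * P u v y"
  \<comment> \<open>For \<open>P = a + b u + c v + d u v\<close> the first differences are
    \<open>b + d v\<close> and \<open>c + d u\<close>, the mixed one is \<open>d\<close>, and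
    \<open>(b + d v) (c + d u) - d P = b c - a d\<close>.\<close>
  unfolding P_def base_poly_affine[OF assms(1,2)] rayleigh_diff_def by algebra

text \<open>All bases have the same size, so the polynomial is homogeneous of degree
  \<open>card B - card I\<close>. The factor \<open>t ^ card I\<close> avoids the subtraction of
  naturals.\<close>

lemma base_poly_scale:
  assumes M: "matroid M" and B: "B \<in> bases M" and "finite I"
  shows "t ^ card I * base_poly M I J (\<lambda>c. t * y c) = t ^ card B * base_poly M I J y"
  unfolding base_poly_def sum_distrib_left
proof (rule sum.cong[OF refl])
  fix A assume A: "A \<in> {A. A \<in> bases M \<and> I \<subseteq> A \<and> A \<inter> J = {}}"
  then have "card B = card I + card (A - I)"
    using card_base_eq[OF M _ B, of A] finite_base[OF M, of A] assms(3)
      card_mono[of A I]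
    by (simp add: card_Diff_subset)
  then show "t ^ card I * (\<Prod>c\<in>A - I. t * y c) = t ^ card B * (\<Prod>c\<in>A - I. y c)"
    by (simp add: prod.distrib power_add)
qed

text \<open>Both products have degree \<open>2 * card B - 2\<close>; the factor \<open>t ^ 2\<close>
  again replaces the subtraction.\<close>

lemma rayleigh_diff_scale:
  assumes M: "matroid M" and B: "B \<in> bases M" and "e \<noteq> f"
  shows "t ^ 2 * rayleigh_diff M e f (\<lambda>c. t * y c) = (t ^ card B) ^ 2 * rayleigh_diff M e f y"
proof -
  note s = base_poly_scale[OF M B, where t = t and y = y]
  have eq: "t * base_poly M {e} {f} (\<lambda>c. t * y c) = t ^ card B * base_poly M {e} {f} y"
    "t * base_poly M {f} {e} (\<lambda>c. t * y c) = t ^ card B * base_poly M {f} {e} y"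
    "t ^ 2 * base_poly M {e, f} {} (\<lambda>c. t * y c) = t ^ card B * base_poly M {e, f} {} y"
    "base_poly M {} {e, f} (\<lambda>c. t * y c) = t ^ card B * base_poly M {} {e, f} y"
    using s[of "{e}" "{f}"] s[of "{f}" "{e}"] s[of "{e, f}" "{}"] s[of "{}" "{e, f}"] \<open>e \<noteq> f\<close>
    by (simp_all add: power2_eq_square)
  have "t ^ 2 * rayleigh_diff M e f (\<lambda>c. t * y c) =
      (t * base_poly M {e} {f} (\<lambda>c. t * y c)) * (t * base_poly M {f} {e} (\<lambda>c. t * y c))
      - (t ^ 2 * base_poly M {e, f} {} (\<lambda>c. t * y c)) * base_poly M {} {e, f} (\<lambda>c. t * y c)"
    by (simp add: rayleigh_diff_def algebra_simps power2_eq_square)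
  also have "\<dots> = (t ^ card B) ^ 2 * rayleigh_diff M e f y"
    unfolding eq by (simp add: rayleigh_diff_def algebra_simps power2_eq_square)
  finally show ?thesis .
qed

section \<open>Parallel extensions\<close>

lemma matroid_parallel_ext:
  assumes M: "matroid M" and m: "m \<in> multiplicities M"
  shows "matroid (parallel_ext M m)"
proof
  let ?N = "parallel_ext M m"
  show "finite (ground ?N)"
    using matroid.finite_ground[OF M] by (simp add: parallel_ext_def)
  show "B \<in> bases ?N \<Longrightarrow> B \<subseteq> ground ?N" for B
    by (simp add: parallel_ext_def)
  obtain B where B: "B \<in> bases M"
    using matroid.bases_nonempty[OF M] by blast
  \<comment> \<open>Positive multiplicities make copy \<open>0\<close> of every element
    available.\<close>
  have "(\<lambda>c. (c, 0)) ` B \<in> bases ?N"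
    using B m matroid.bases_subset[OF M B]
    by (auto simp: parallel_ext_def multiplicities_def inj_on_def image_image)
  then show "bases ?N \<noteq> {}" by blast
  fix B1 B2 x
  assume B1: "B1 \<in> bases ?N" and B2: "B2 \<in> bases ?N" and x: "x \<in> B1 - B2"
  have inj: "inj_on fst B1" and fst: "fst ` B1 \<in> bases M" "fst ` B2 \<in> bases M"
    and sub: "B1 \<subseteq> ground ?N" "B2 \<subseteq> ground ?N"
    using B1 B2 by (auto simp: parallel_ext_def)
  have img: "fst ` (B1 - {x}) = fst ` B1 - {fst x}"
    using inj_on_image_set_diff[OF inj, of B1 "{x}"] x by auto
  have "\<exists>y\<in>B2 - B1. fst y \<notin> fst ` (B1 - {x}) \<and> insert (fst y) (fst ` (B1 - {x})) \<in> bases M"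
  \<comment> \<open>If \<open>B2\<close> contains a copy of the element underlying \<open>x\<close>,
    swap the two copies, which keeps the projection. Otherwise exchange in \<open>M\<close> and lift
    the incoming element to its copy in \<open>B2\<close>.\<close>
  proof (cases "fst x \<in> fst ` B2")
    case True
    then obtain y where y: "y \<in> B2" "fst y = fst x" by force
    then have "y \<notin> B1"
      using x inj_onD[OF inj, of x y] by auto
    moreover have "insert (fst y) (fst ` (B1 - {x})) = fst ` B1"
      using x y unfolding img by auto
    ultimately show ?thesis
      using y fst img by auto
  next
    case False
    then obtain g where g: "g \<in> fst ` B2 - fst ` B1" "insert g (fst ` B1 - {fst x}) \<in> bases M"
      using matroid.base_exchange[OF M fst, of "fst x"] x by blast
    then obtain y where y: "y \<in> B2" "fst y = g" by blast
    then have "y \<in> B2 - B1"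
      using g(1) by blast
    then show ?thesis
      unfolding img using g y(2) by (intro bexI[of _ y]) auto
  qed
  then obtain y where y: "y \<in> B2 - B1" "fst y \<notin> fst ` (B1 - {x})"
    "insert (fst y) (fst ` (B1 - {x})) \<in> bases M"
    by blast
  have "insert y (B1 - {x}) \<subseteq> ground ?N"
    using sub y by blast
  moreover have "inj_on fst (insert y (B1 - {x}))"
    using y inj by (auto intro: inj_on_subset)
  ultimately have "insert y (B1 - {x}) \<in> bases ?N"
    using y by (simp add: parallel_ext_def)
  then show "\<exists>y\<in>B2 - B1. insert y (B1 - {x}) \<in> bases ?N"
    using y by blast
qed

text \<open>Group the bases by their projection \<open>B\<close>. Those over \<open>B\<close> are
  the graphs of functions choosing one copy per element, so by distributivity their total weight is
  a product of class sums. \<open>rayleigh_diff_finite_differences\<close> then transfers the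
  Rayleigh differences.\<close>

lemma base_poly_parallel_ext:
  assumes M: "matroid M"
  shows "base_poly (parallel_ext M m) {} {} y = base_poly M {} {} (\<lambda>c. \<Sum>i<m c. y (c, i))"
proof -
  let ?N = "parallel_ext M m"
  let ?graph = "\<lambda>B g. (\<lambda>c. (c, g c :: nat)) ` B"
  let ?T = "\<lambda>B. {X. X \<subseteq> Sigma B (\<lambda>c. {..<m c}) \<and> inj_on fst X \<and> fst ` X = B}"
  have "(\<Sum>X\<in>bases ?N. prod y X) = (\<Sum>B\<in>bases M. \<Sum>X\<in>{X \<in> bases ?N. fst ` X = B}. prod y X)"
  proof (rule sum.group[symmetric])
    show "finite (bases ?N)"
      by (rule finite_subset[of _ "Pow (Sigma (ground M) (\<lambda>c. {..<m c}))"])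
        (use matroid.finite_ground[OF M] in \<open>auto simp: parallel_ext_def\<close>)
    show "(`) fst ` bases ?N \<subseteq> bases M"
      by (auto simp: parallel_ext_def)
  qed (rule finite_bases[OF M])
  also have "\<dots> = (\<Sum>B\<in>bases M. \<Prod>c\<in>B. \<Sum>i<m c. y (c, i))"
  proof (rule sum.cong[OF refl])
    fix B assume B: "B \<in> bases M"
    have "{X \<in> bases ?N. fst ` X = B} = ?T B"
    proof (intro equalityI subsetI)
      fix X assume "X \<in> {X \<in> bases ?N. fst ` X = B}"
      then have X: "X \<subseteq> Sigma (ground M) (\<lambda>c. {..<m c})" "inj_on fst X" "fst ` X = B"
        by (simp_all add: parallel_ext_def)
      have "X \<subseteq> Sigma B (\<lambda>c. {..<m c})"
        using X(1) unfolding X(3)[symmetric] by force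
      with X show "X \<in> ?T B" by simp
    next
      fix X assume X: "X \<in> ?T B"
      have "Sigma B (\<lambda>c. {..<m c}) \<subseteq> Sigma (ground M) (\<lambda>c. {..<m c})"
        using matroid.bases_subset[OF M B] by (rule Sigma_mono) simp
      then have "X \<subseteq> Sigma (ground M) (\<lambda>c. {..<m c})"
        using X by blast
      with X B show "X \<in> {X \<in> bases ?N. fst ` X = B}"
        by (simp add: parallel_ext_def)
    qed
    also have "\<dots> = ?graph B ` (\<Pi>\<^sub>E c\<in>B. {..<m c})"
    proof
      show "?graph B ` (\<Pi>\<^sub>E c\<in>B. {..<m c}) \<subseteq> ?T B"
        by (auto simp: inj_on_def image_image PiE_iff)
      show "?T B \<subseteq> ?graph B ` (\<Pi>\<^sub>E c\<in>B. {..<m c})"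
      proof
        fix X assume X: "X \<in> ?T B"
        \<comment> \<open>\<open>g c\<close> is the index of the unique copy of \<open>c\<close> in
          \<open>X\<close>; restricting to \<open>B\<close> makes \<open>g\<close> extensional, as
          \<open>\<Pi>\<^sub>E\<close> demands.\<close>
        define g where "g = (\<lambda>c\<in>B. snd (the_inv_into X fst c))"
        have graph: "(c, g c) \<in> X" if "c \<in> B" for c
        proof -
          have "c \<in> fst ` X" using X that by simp
          then have "the_inv_into X fst c \<in> X" "fst (the_inv_into X fst c) = c"
            using X the_inv_into_into[of fst X c X] f_the_inv_into_f[of fst X c] by auto
          then show ?thesis using that by (simp add: g_def) (metis prod.collapse)
        qed
        have "X = ?graph B g"
        proof
          show "?graph B g \<subseteq> X" using graph by auto
          show "X \<subseteq> ?graph B g"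
          proof
            fix p assume p: "p \<in> X"
            then have "fst p \<in> B" using X by auto
            then have "(fst p, g (fst p)) = p"
              using X p graph by (intro inj_onD[of fst X]) auto
            with \<open>fst p \<in> B\<close> show "p \<in> ?graph B g" by force
          qed
        qed
        moreover have "g \<in> (\<Pi>\<^sub>E c\<in>B. {..<m c})"
        proof (rule PiE_I)
          show "g c \<in> {..<m c}" if "c \<in> B" for c
            using graph[OF that] X by auto
        qed (simp add: g_def)
        ultimately show "X \<in> ?graph B ` (\<Pi>\<^sub>E c\<in>B. {..<m c})" by blast
      qed
    qed
    finally have img: "{X \<in> bases ?N. fst ` X = B} = ?graph B ` (\<Pi>\<^sub>E c\<in>B. {..<m c})" .
    have inj: "inj_on (?graph B) (\<Pi>\<^sub>E c\<in>B. {..<m c})"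
    proof (rule inj_onI)
      fix g h assume "g \<in> (\<Pi>\<^sub>E c\<in>B. {..<m c})" "h \<in> (\<Pi>\<^sub>E c\<in>B. {..<m c})" "?graph B g = ?graph B h"
      then show "g = h"
        by (intro PiE_ext[of g B _ h]) auto
    qed
    have "(\<Sum>X\<in>{X \<in> bases ?N. fst ` X = B}. prod y X) =
        (\<Sum>g\<in>(\<Pi>\<^sub>E c\<in>B. {..<m c}). \<Prod>c\<in>B. y (c, g c))"
      unfolding img sum.reindex[OF inj] by (simp add: prod.reindex inj_on_def)
    also have "\<dots> = (\<Prod>c\<in>B. \<Sum>i<m c. y (c, i))"
      using finite_base[OF M B] by (simp add: prod_sum_PiE)
    finally show "(\<Sum>X\<in>{X \<in> bases ?N. fst ` X = B}. prod y X) = (\<Prod>c\<in>B. \<Sum>i<m c. y (c, i))" .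
  qed
  finally show ?thesis by (simp add: base_poly_def)
qed

lemma rayleigh_diff_parallel_ext:
  assumes M: "matroid M" and m: "m \<in> multiplicities M" and "e \<noteq> f" "i < m e" "j < m f"
  shows "rayleigh_diff (parallel_ext M m) (e, i) (f, j) y =
    rayleigh_diff M e f (\<lambda>c. \<Sum>i<m c. y (c, i))"
proof -
  define s where "s = (\<lambda>c. \<Sum>i<m c. y (c, i))"
  \<comment> \<open>\<open>u\<close> and \<open>v\<close> are the weights of the classes of
    \<open>e\<close> and \<open>f\<close> without copies \<open>i\<close> and \<open>j\<close>.
    Giving these copies weights \<open>a\<close> and \<open>b\<close> makes the class weights
    \<open>u + a\<close> and \<open>v + b\<close>.\<close>
  define u v where "u = s e - y (e, i)" and "v = s f - y (f, j)"
  have "(\<lambda>c. \<Sum>k<m c. (y((e, i) := a, (f, j) := b)) (c, k)) = s(e := u + a, f := v + b)" for a b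
  proof
    fix c
    have upd: "(\<Sum>k<m g. (y((g, l) := a)) (g, k)) = s g - y (g, l) + a" if "l < m g" for g l a
      using that by (simp add: s_def sum.remove[of "{..<m g}" l])
    show "(\<Sum>k<m c. (y((e, i) := a, (f, j) := b)) (c, k)) = (s(e := u + a, f := v + b)) c"
      using upd[OF assms(4), of a] upd[OF assms(5), of b] \<open>e \<noteq> f\<close>
      by (auto simp: u_def v_def s_def cong: if_cong)
  qed
  then have "base_poly (parallel_ext M m) {} {} (y((e, i) := a, (f, j) := b)) =
      base_poly M {} {} (s(e := u + a, f := v + b))" for a b
    by (simp add: base_poly_parallel_ext[OF M])
  \<comment> \<open>Base point \<open>(0, 0)\<close> in the extension corresponds to
    \<open>(u, v)\<close> in \<open>M\<close>, so the finite differences coincide term by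
    term.\<close>
  then show ?thesis
    using rayleigh_diff_finite_differences[OF matroid_parallel_ext[OF M m], of "(e, i)" "(f, j)" y 0 0]
      rayleigh_diff_finite_differences[OF M \<open>e \<noteq> f\<close>, of s u v] \<open>e \<noteq> f\<close>
    by (simp add: s_def)
qed

section \<open>Implications between the conditions on \<open>M\<close> and on its extensions\<close>

lemma rayleigh_parallel_ext:
  assumes M: "matroid M" and R: "rayleigh M" and m: "m \<in> multiplicities M"
  shows "rayleigh (parallel_ext M m)"
  unfolding rayleigh_def
proof (intro ballI impI allI)
  let ?N = "parallel_ext M m"
  fix p q and y :: "'a \<times> nat \<Rightarrow> real"
  assume "p \<in> ground ?N" "q \<in> ground ?N" and pq: "p \<noteq> q" and y: "\<forall>c\<in>ground ?N. y c > 0"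
  then obtain e i f j where e: "p = (e, i)" "e \<in> ground M" "i < m e"
    and f: "q = (f, j)" "f \<in> ground M" "j < m f"
    by (auto simp: parallel_ext_def)
  show "rayleigh_diff ?N p q y \<ge> 0"
  proof (cases "e = f")
    case True
    \<comment> \<open>A basis holds at most one copy of an element, so the subtracted product
      vanishes.\<close>
    then have "\<not> inj_on fst X" if "{p, q} \<subseteq> X" for X
      using that pq e(1) f(1) True by (metis inj_onD fst_conv insert_subset)
    then have "base_poly ?N {p, q} {} y = 0"
      unfolding base_poly_def by (intro sum.neutral) (auto simp: parallel_ext_def)
    moreover have "base_poly ?N I J y \<ge> 0" for I J
      using y by (intro base_poly_nonneg matroid_parallel_ext M m) (auto simp: less_imp_le)
    ultimately show ?thesis by (simp add: rayleigh_diff_def)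
  next
    case False
    have "(\<Sum>i<m c. y (c, i)) > 0" if "c \<in> ground M" for c
      using that m y by (intro sum_pos) (auto simp: parallel_ext_def multiplicities_def)
    then show ?thesis
      using R e f False by (simp add: rayleigh_diff_parallel_ext[OF M m] rayleigh_def)
  qed
qed

lemma rayleigh_if_negatively_correlated_parallel_ext:
  assumes M: "matroid M"
    and NC: "\<And>m. m \<in> multiplicities M \<Longrightarrow> negatively_correlated (parallel_ext M m)"
  shows "rayleigh M"
  unfolding rayleigh_def
proof (intro ballI impI allI)
  fix e f and y :: "'a \<Rightarrow> real"
  assume e: "e \<in> ground M" and f: "f \<in> ground M" and ef: "e \<noteq> f"
    and y: "\<forall>c\<in>ground M. y c > 0"
  obtain B where B: "B \<in> bases M"
    using matroid.bases_nonempty[OF M] by blast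
  \<comment> \<open>At unit weights the class of \<open>c\<close> has weight \<open>m c\<close>, so
    negative correlation of the extension is the inequality for \<open>M\<close> at the integer
    point \<open>m\<close>.\<close>
  have int: "rayleigh_diff M e f (\<lambda>c. real (m c)) \<ge> 0" if m: "m \<in> multiplicities M" for m
  proof -
    have "m e > 0" "m f > 0"
      using m e f by (auto simp: multiplicities_def)
    then have "rayleigh_diff (parallel_ext M m) (e, 0) (f, 0) (\<lambda>_. 1) \<ge> 0"
      using NC[OF m] e f ef by (simp add: negatively_correlated_def parallel_ext_def)
    then show ?thesis
      using rayleigh_diff_parallel_ext[OF M m ef \<open>m e > 0\<close> \<open>m f > 0\<close>, of "\<lambda>_. 1"] by simp
  qed
  \<comment> \<open>\<open>z n c\<close> rounds \<open>y c\<close> up to a multiple of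
    \<open>1 / Suc n\<close>. Rounding up keeps the numerators positive on \<open>ground M\<close>,
    so they form a family of multiplicities.\<close>
  define z where "z n c = real (nat \<lceil>real (Suc n) * y c\<rceil>) / real (Suc n)" for n c
  have z_nonneg: "rayleigh_diff M e f (z n) \<ge> 0" for n
  proof -
    let ?t = "real (Suc n)"
    have "(\<lambda>c. nat \<lceil>?t * y c\<rceil>) \<in> multiplicities M"
      using y by (simp add: multiplicities_def del: of_nat_Suc)
    then have "rayleigh_diff M e f (\<lambda>c. ?t * z n c) \<ge> 0"
      using int by (simp add: z_def del: of_nat_Suc)
    \<comment> \<open>Homogeneity clears the common denominator; the power of \<open>?t\<close> is
      positive and cancels.\<close>
    then have "(?t ^ card B) ^ 2 * rayleigh_diff M e f (z n) \<ge> 0"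
      unfolding rayleigh_diff_scale[OF M B ef, symmetric] by simp
    then show ?thesis
      by (simp add: zero_le_mult_iff del: of_nat_Suc)
  qed
  \<comment> \<open>Convergence is required at every \<open>c\<close>. Off \<open>ground M\<close>
    the weight \<open>y c\<close> may be negative, and \<open>nat\<close> cuts it off at
    \<open>0\<close>; hence the limit \<open>max 0 (y c)\<close>, which agrees with \<open>y\<close>
    on \<open>ground M\<close>.\<close>
  have lim: "(\<lambda>n. z n c) \<longlonglongrightarrow> max 0 (y c)" for c
  proof -
    define w where "w = max 0 (y c)"
    have "real (Suc n) * w \<le> real (nat \<lceil>real (Suc n) * y c\<rceil>)
        \<and> real (nat \<lceil>real (Suc n) * y c\<rceil>) \<le> real (Suc n) * w + 1" for n
    proof (cases "y c \<ge> 0")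
      case True
      then show ?thesis
        by (simp add: w_def max_def of_nat_nat le_of_int_ceiling del: of_nat_Suc)
    next
      case False
      then have "real (Suc n) * y c \<le> 0"
        by (simp add: mult_nonneg_nonpos del: of_nat_Suc)
      then show ?thesis
        using False by (simp add: w_def max_def ceiling_le_zero del: of_nat_Suc)
    qed
    then have bounds: "w \<le> z n c" "z n c \<le> w + inverse (real (Suc n))" for n
      by (simp_all add: z_def field_simps del: of_nat_Suc)
    have "(\<lambda>n. z n c) \<longlonglongrightarrow> w"
      by (rule tendsto_sandwich[OF _ _ tendsto_const LIMSEQ_inverse_real_of_nat_add])
        (use bounds in \<open>auto simp del: of_nat_Suc\<close>)
    then show ?thesis by (simp add: w_def)
  qed
  have "rayleigh_diff M e f (\<lambda>c. max 0 (y c)) \<ge> 0"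
    by (rule tendsto_lowerbound[OF tendsto_rayleigh_diff[OF lim] always_eventually])
      (use z_nonneg in auto)
  also have "rayleigh_diff M e f (\<lambda>c. max 0 (y c)) = rayleigh_diff M e f y"
  proof -
    have "base_poly M I J (\<lambda>c. max 0 (y c)) = base_poly M I J y" for I J
      by (rule base_poly_cong[OF M]) (use y in \<open>simp add: max_def less_imp_le\<close>)
    then show ?thesis by (simp add: rayleigh_diff_def)
  qed
  finally show "rayleigh_diff M e f y \<ge> 0" .
qed

theorem theorem3p6:
  fixes M :: "'a base_system"
  assumes "matroid M"
  shows "(rayleigh M \<longleftrightarrow> (\<forall>m \<in> multiplicities M. rayleigh (parallel_ext M m)))
    \<and> (rayleigh M \<longleftrightarrow> (\<forall>m \<in> multiplicities M. balanced (parallel_ext M m)))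
    \<and> (rayleigh M \<longleftrightarrow> (\<forall>m \<in> multiplicities M. negatively_correlated (parallel_ext M m)))"
  \<comment> \<open>The conditions form a cycle: Rayleigh for \<open>M\<close>, Rayleigh, balanced
    and negatively correlated for all extensions, and back to \<open>M\<close>.\<close>
  using assms rayleigh_parallel_ext matroid_parallel_ext rayleigh_imp_balanced
    balanced_imp_negatively_correlated rayleigh_if_negatively_correlated_parallel_ext
  by metis

end
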